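(* Let $r\in\mathbb{N}$, $m_1,\ldots,m_r\in\mathbb{N}$, $m=\operatorname{lcm}[m_1,\ldots,m_r]$, and $M\in\mathbb{N}$ with $m\mid M$. Let $f_1,\ldots,f_r:\mathbb{N}\to\mathbb{C}$ be arbitrary arithmetical functions and $G=(g_1,\ldots,g_r)$ a system of polynomials with integer coefficients. Then \[ \frac{1}{\phi(M)}\sum_{\substack{k=1\\ \gcd(k,M)=1}}^{M} f_1(\gcd(g_1(k),m_1))\cdots f_r(\gcd(g_r(k),m_r)) =\sum_{d_1\mid m_1,\ldots,d_r\mid m_r}\frac{(\mu*f_1)(d_1)\cdots(\mu*f_r)(d_r)}{\phi(\operatorname{lcm}[d_1,\ldots,d_r])}\,\eta_G(d_1,\ldots,d_r); \] in particular the left-hand side does not depend on the choice of $M$.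
   Context: $\mathbb{N}=\{1,2,\ldots\}$. $\phi$ is Euler's totient function, $\mu$ the Möbius function, and $(f*g)(n)=\sum_{d\mid n}f(d)g(n/d)$ the Dirichlet convolution. For a system $G=(g_1,\ldots,g_r)$ of integer polynomials and $d_1,\ldots,d_r\in\mathbb{N}$, $\eta_G(d_1,\ldots,d_r)$ is the number of residues $x$ modulo $\operatorname{lcm}[d_1,\ldots,d_r]$ such that $g_i(x)\equiv 0\pmod{d_i}$ and $\gcd(x,d_i)=1$ for all $1\le i\le r$. *)

theory Defs
  imports
    Complex_Main
    "HOL-Number_Theory.Number_Theory"
    "HOL-Computational_Algebra.Computational_Algebra"
begin

text \<open>
  Arithmetical functions \<open>\<nat> \<rightarrow> \<complex>\<close> with \<open>\<nat> = {1, 2, \<dots>}\<close> are represented as functions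
  on the type \<^typ>\<open>nat\<close>; only their values at positive arguments are relevant.
  Systems indexed by \<open>1, \<dots>, r\<close> are functions on \<^typ>\<open>nat\<close> of which only the values on
  \<open>{1..r}\<close> are used.
\<close>

definition moebius_mu :: "nat \<Rightarrow> complex" where
  "moebius_mu n = (if squarefree n then (-1) ^ card (prime_factors n) else 0)"

definition dirichlet_conv :: "(nat \<Rightarrow> complex) \<Rightarrow> (nat \<Rightarrow> complex) \<Rightarrow> nat \<Rightarrow> complex" where
  "dirichlet_conv f g n = (\<Sum>d | d dvd n. f d * g (n div d))"

text \<open>Residue classes modulo the lcm are represented by their least non-negative elements.\<close>

definition eta :: "nat \<Rightarrow> (nat \<Rightarrow> int poly) \<Rightarrow> (nat \<Rightarrow> nat) \<Rightarrow> nat" where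
  "eta r G d = card {x \<in> {0..<int (LCM i\<in>{1..r}. d i)}.
     \<forall>i\<in>{1..r}. [poly (G i) x = 0] (mod int (d i)) \<and> gcd x (int (d i)) = 1}"

end

theory Submission
  imports Defs
begin

text \<open>
  By Moebius inversion \<open>f\<^sub>i(gcd(g\<^sub>i(k), m\<^sub>i))\<close> is the sum of \<open>(\<mu> * f\<^sub>i)(d)\<close> over all \<open>d\<close> dividing both
  \<open>m\<^sub>i\<close> and \<open>g\<^sub>i(k)\<close>. Expanding the product and exchanging the sums, one has to count the units \<open>k\<close>
  modulo \<open>M\<close> with \<open>d\<^sub>i | g\<^sub>i(k)\<close> for all \<open>i\<close>. This condition depends only on \<open>k\<close> modulo
  \<open>L = lcm[d\<^sub>1, \<dots>, d\<^sub>r]\<close>, and reduction from the units modulo \<open>M\<close> onto the units modulo \<open>L\<close> has fibres of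
  equal size \<open>\<phi>(M) / \<phi>(L)\<close>, so the count is \<open>\<phi>(M) / \<phi>(L) \<cdot> \<eta>\<^sub>G(d\<^sub>1, \<dots>, d\<^sub>r)\<close>.
\<close>

section \<open>Moebius inversion\<close>

lemma moebius_mu_prime_mult:
  assumes "prime p" "\<not> p dvd d" "d > 0"
  shows "moebius_mu (p * d) = - moebius_mu d"
proof -
  have cop: "coprime p d"
    using assms by (simp add: prime_imp_coprime)
  have sq: "squarefree (p * d) \<longleftrightarrow> squarefree d"
    using assms cop by (auto intro: squarefree_mult_coprime squarefree_prime dest: squarefree_multD)
  have pf: "prime_factors (p * d) = insert p (prime_factors d)"
    using assms by (auto simp: prime_factors_product prime_factorization_prime)
  have "p \<notin> prime_factors d"
    using assms by auto
  then show ?thesis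
    unfolding moebius_mu_def sq pf by simp
qed

text \<open>For a prime \<open>p\<close> dividing \<open>n\<close>, multiplication by
  \<open>p\<close> matches the squarefree divisors prime to \<open>p\<close> with those divisible by
  \<open>p\<close> and flips the sign of \<open>moebius_mu\<close>, so everything cancels.\<close>

lemma sum_moebius_mu_divisors:
  assumes "n > 0"
  shows "(\<Sum>d | d dvd n. moebius_mu d) = (if n = 1 then 1 else 0)"
proof (cases "n = 1")
  case True
  then show ?thesis by (simp add: moebius_mu_def)
next
  case False
  then obtain p where p: "prime p" "p dvd n"
    using prime_factor_nat by blast
  define A where "A = {d. d dvd n \<and> squarefree d \<and> \<not> p dvd d}"
  define B where "B = {d. d dvd n \<and> squarefree d \<and> p dvd d}"
  have fin: "finite {d. d dvd n}"
    using assms by simp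
  have finAB: "finite A" "finite B"
    unfolding A_def B_def by (auto intro: finite_subset[OF _ fin])
  have "(\<Sum>d\<in>B. moebius_mu d) = (\<Sum>d\<in>A. - moebius_mu d)"
  proof (rule sum.reindex_bij_witness[where i = "\<lambda>d. p * d" and j = "\<lambda>d. d div p"])
    fix d assume d: "d \<in> B"
    then obtain e where e: "d = p * e"
      by (auto simp: B_def)
    have p0: "p > 0"
      using p(1) by (simp add: prime_gt_0_nat)
    have sq: "squarefree (p * e)"
      using d e by (simp add: B_def)
    have "\<not> p dvd e"
    proof
      assume "p dvd e"
      then have "p ^ 2 dvd p * e"
        by (simp add: power2_eq_square)
      with sq have "p dvd 1"
        unfolding squarefree_def by blast
      with p(1) show False
        by simp
    qed
    moreover have "squarefree e"
      using sq squarefree_multD(2) by blast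
    moreover have "e dvd n"
      using d e by (auto simp: B_def elim: dvd_mult_right)
    ultimately show "d div p \<in> A"
      using e p0 by (simp add: A_def)
    have "e > 0"
      using \<open>\<not> p dvd e\<close> by (cases e) auto
    show "p * (d div p) = d"
      using e p0 by simp
    show "- moebius_mu (d div p) = moebius_mu d"
      using e p0 moebius_mu_prime_mult[OF p(1) \<open>\<not> p dvd e\<close> \<open>e > 0\<close>] by simp
  next
    fix d assume d: "d \<in> A"
    have p0: "p > 0"
      using p(1) by (simp add: prime_gt_0_nat)
    show "p * d div p = d"
      using p0 by simp
    have cop: "coprime p d"
      using d p by (simp add: A_def prime_imp_coprime)
    show "p * d \<in> B"
      using d p cop
      by (auto simp: A_def B_def intro: divides_mult squarefree_mult_coprime squarefree_prime)
  qed
  \<comment> \<open>The divisors outside \<open>A\<close> and \<open>B\<close> are not squarefree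
    and contribute zero.\<close>
  moreover have "(\<Sum>d | d dvd n. moebius_mu d) = (\<Sum>d\<in>A \<union> B. moebius_mu d)"
    by (rule sum.mono_neutral_right) (use fin in \<open>auto simp: A_def B_def moebius_mu_def\<close>)
  moreover have "\<dots> = (\<Sum>d\<in>A. moebius_mu d) + (\<Sum>d\<in>B. moebius_mu d)"
    by (rule sum.union_disjoint) (use finAB in \<open>auto simp: A_def B_def\<close>)
  ultimately show ?thesis
    using False by (simp add: sum_negf)
qed

text \<open>Grouping the double sum by the argument \<open>b\<close> of \<open>f\<close> leaves the
  full divisor sum of \<open>moebius_mu\<close> over \<open>n div b\<close> as coefficient, which
  vanishes unless \<open>b = n\<close>.\<close>

lemma moebius_inversion:
  assumes "n > 0"
  shows "(\<Sum>d | d dvd n. dirichlet_conv moebius_mu f d) = f n"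
proof -
  have fin: "finite {d. d dvd k}" if "k dvd n" for k
    using assms that by (auto intro!: finite_divisors_nat dest: dvd_pos_nat)
  have "(\<Sum>d | d dvd n. dirichlet_conv moebius_mu f d) =
      (\<Sum>(d, e)\<in>(SIGMA d:{d. d dvd n}. {e. e dvd d}). moebius_mu e * f (d div e))"
    unfolding dirichlet_conv_def using fin by (subst sum.Sigma) auto
  \<comment> \<open>Substitution \<open>d = b * e\<close>: the condition
    \<open>e dvd d dvd n\<close> becomes \<open>b dvd n\<close> and
    \<open>e dvd n div b\<close>.\<close>
  also have "\<dots> =
      (\<Sum>(b, e)\<in>(SIGMA b:{b. b dvd n}. {e. e dvd n div b}). moebius_mu e * f b)"
  proof (rule sum.reindex_bij_witness[where i = "\<lambda>(b, e). (b * e, e)"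
        and j = "\<lambda>(d, e). (d div e, e)"])
    fix z assume "z \<in> (SIGMA d:{d. d dvd n}. {e. e dvd d})"
    then obtain b e c where "z = (e * b, e)" "n = e * b * c"
      by (auto elim!: dvdE)
    then show "(case case z of (d, e) \<Rightarrow> (d div e, e) of (b, e) \<Rightarrow> (b * e, e)) = z"
      and "(case z of (d, e) \<Rightarrow> (d div e, e)) \<in> (SIGMA b:{b. b dvd n}. {e. e dvd n div b})"
      and "(case case z of (d, e) \<Rightarrow> (d div e, e) of (b, e) \<Rightarrow> moebius_mu e * f b) =
        (case z of (d, e) \<Rightarrow> moebius_mu e * f (d div e))"
      using assms by auto
  next
    fix z assume "z \<in> (SIGMA b:{b. b dvd n}. {e. e dvd n div b})"
    then obtain b e c where "z = (b, e)" "n = b * e * c"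
      using assms by (auto elim!: dvdE)
    then show "(case case z of (b, e) \<Rightarrow> (b * e, e) of (d, e) \<Rightarrow> (d div e, e)) = z"
      and "(case z of (b, e) \<Rightarrow> (b * e, e)) \<in> (SIGMA d:{d. d dvd n}. {e. e dvd d})"
      using assms by auto
  qed
  also have "\<dots> = (\<Sum>b | b dvd n. \<Sum>e | e dvd n div b. moebius_mu e * f b)"
    using fin assms by (subst sum.Sigma) (auto simp: div_dvd_iff_mult)
  also have "\<dots> = (\<Sum>b | b dvd n. if b = n then f b else 0)"
  proof (rule sum.cong[OF refl])
    fix b assume "b \<in> {b. b dvd n}"
    then have "n div b > 0" "n div b = 1 \<longleftrightarrow> b = n"
      using assms by (auto elim!: dvdE)
    then show "(\<Sum>e | e dvd n div b. moebius_mu e * f b) = (if b = n then f b else 0)"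
      by (simp add: sum_distrib_right[symmetric] sum_moebius_mu_divisors del: One_nat_def)
  qed
  also have "\<dots> = f n"
    using fin[of n] by (simp add: sum.delta)
  finally show ?thesis .
qed

section \<open>Reduction of units from modulus \<open>M\<close> to a divisor
  \<open>L\<close>\<close>

lemma coprime_lift_unit:
  fixes a L M :: nat
  assumes "coprime a L" "M > 0"
  obtains k where "coprime k M" "[k = a] (mod L)"
proof -
  \<comment> \<open>Each prime factor of \<open>M\<close> divides exactly one of \<open>a\<close> and \<open>t\<close>, so it cannot divide \<open>a + L * t\<close>.\<close>
  define t where "t = \<Prod>{p \<in> prime_factors M. \<not> p dvd a}"
  have t: "p dvd t \<longleftrightarrow> \<not> p dvd a" if p: "prime p" "p dvd M" for p
  proof
    assume "p dvd t"
    then obtain q where q: "q \<in> prime_factors M" "\<not> q dvd a" "p dvd q"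
      unfolding t_def using p by (auto simp: prime_dvd_prod_iff)
    then have "p = q"
      using p(1) by (intro primes_dvd_imp_eq) auto
    with q show "\<not> p dvd a" by simp
  next
    assume "\<not> p dvd a"
    then show "p dvd t"
      unfolding t_def using p assms(2)
      by (intro dvd_prod_eqI[where f = "\<lambda>x. x" and a = p]) (auto simp: prime_factors_dvd)
  qed
  have "coprime (a + L * t) M"
  proof (rule ccontr)
    assume "\<not> coprime (a + L * t) M"
    then obtain p where p: "prime p" "p dvd a + L * t" "p dvd M"
      using prime_factor_nat[of "gcd (a + L * t) M"] by (auto simp del: One_nat_def)
    show False
    proof (cases "p dvd a")
      case True
      then have "p dvd L * t"
        using p by (simp add: dvd_add_right_iff)
      moreover have "\<not> p dvd L"
        using assms(1) p(1) True not_prime_unit unfolding coprime_def by blast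
      ultimately show False
        using t[OF p(1,3)] p(1) True by (simp add: prime_dvd_mult_iff)
    next
      case False
      then have "p dvd L * t"
        using t[OF p(1,3)] by simp
      then show False
        using p False by (simp add: dvd_add_left_iff)
    qed
  qed
  moreover have "[a + L * t = a] (mod L)"
    by (simp add: cong_def)
  ultimately show ?thesis
    using that by blast
qed

text \<open>The residue ranges \<open>{1..n}\<close> and \<open>{..<n}\<close> differ only in
  \<open>n\<close> and \<open>0\<close>, neither of which is coprime to \<open>n > 1\<close>. For
  \<open>n = 1\<close> the two sets are \<open>{1}\<close> and \<open>{0}\<close>, so modulus 1 is
  treated separately below.\<close>

lemma totatives_eq_lessThan:
  assumes "n > 1"
  shows "totatives n = {x \<in> {..<n}. coprime x n}"
  using assms by (auto simp: totatives_def intro!: Nat.gr0I le_neq_implies_less)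

lemma card_coprime_lessThan:
  assumes "n > 0"
  shows "card {x \<in> {..<n}. coprime x n} = totient n"
proof (cases "n = 1")
  case True
  then have "{x \<in> {..<n}. coprime x n} = {0}" by auto
  then show ?thesis using True by simp
next
  case False
  then show ?thesis
    using assms by (simp add: totatives_eq_lessThan totient_def)
qed

lemma card_units_in_class:
  fixes a L M :: nat
  assumes "L dvd M" "M > 0" "coprime a L"
  shows "card {k \<in> {..<M}. coprime k M \<and> [k = a] (mod L)} =
         card {k \<in> {..<M}. coprime k M \<and> [k = 1] (mod L)}"
proof -
  \<comment> \<open>\<open>a\<close> is coprime to \<open>L\<close> only and may fail to be
    invertible modulo \<open>M\<close>; its lift \<open>u\<close> is invertible.\<close>
  obtain u where u: "coprime u M" "[u = a] (mod L)"
    using coprime_lift_unit assms(2,3) by blast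
  obtain v where v: "[u * v = 1] (mod M)"
    using u(1) cong_solve_coprime_nat by auto
  have cop_v: "coprime v M"
    using v by (metis coprime_iff_invertible_nat mult.commute One_nat_def)
  have modL: "(x mod M) mod L = x mod L" for x
    using assms(1) by (simp add: mod_mod_cancel)
  have uvL: "[u * v = 1] (mod L)"
    using v assms(1) cong_dvd_modulus_nat by blast
  \<comment> \<open>Division by a unit \<open>u\<close> lifting \<open>a\<close> carries the fibre over \<open>a\<close> to the fibre over \<open>1\<close>.\<close>
  have "bij_betw (\<lambda>k. k * v mod M) {k \<in> {..<M}. coprime k M \<and> [k = a] (mod L)}
          {k \<in> {..<M}. coprime k M \<and> [k = 1] (mod L)}"
  proof (rule bij_betwI[where g = "\<lambda>k. k * u mod M"]; clarsimp simp: Pi_iff assms(2) u cop_v)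
    fix k assume "[k = a] (mod L)"
    then have "[k * v = u * v] (mod L)"
      using u(2) by (intro cong_mult) (auto simp: cong_def)
    with uvL have "[k * v = 1] (mod L)"
      by (rule cong_trans[rotated])
    then show "[k * v mod M = Suc 0] (mod L)"
      by (simp add: cong_def modL)
  next
    fix k assume "[k = Suc 0] (mod L)"
    then have "[k * u = 1 * a] (mod L)"
      using u(2) by (intro cong_mult) auto
    then show "[k * u mod M = a] (mod L)"
      by (simp add: cong_def modL)
  next
    fix k assume "k < M"
    have "[k * (u * v) = k * 1] (mod M)"
      using v by (intro cong_mult) auto
    with \<open>k < M\<close> show "(k * v mod M) * u mod M = k"
      by (simp add: cong_def mod_simps mult_ac)
  next
    fix k assume "k < M"
    have "[k * (u * v) = k * 1] (mod M)"
      using v by (intro cong_mult) auto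
    with \<open>k < M\<close> show "(k * u mod M) * v mod M = k"
      by (simp add: cong_def mod_simps mult_ac)
  qed
  then show ?thesis
    by (rule bij_betw_same_card)
qed

text \<open>A condition periodic modulo \<open>L\<close> selects whole fibres of the reduction map,
  and all fibres over units have the same size \<open>c\<close>. The product form avoids division in
  the naturals.\<close>

lemma card_units_periodic:
  fixes L M :: nat and P :: "nat \<Rightarrow> bool"
  assumes "L dvd M" "M > 0" and per: "\<And>k. P (k mod L) = P k"
  shows "totient L * card {k \<in> {..<M}. coprime k M \<and> P k} =
         totient M * card {x \<in> {..<L}. coprime x L \<and> P x}"
proof -
  define c where "c = card {k \<in> {..<M}. coprime k M \<and> [k = 1] (mod L)}"
  have L: "L > 0"
    using assms by (auto intro: dvd_pos_nat)
  have count: "card {k \<in> {..<M}. coprime k M \<and> Q k} = card {x \<in> {..<L}. coprime x L \<and> Q x} * c"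
    if Q: "\<And>k. Q (k mod L) = Q k" for Q
  proof -
    have eq: "{k \<in> {..<M}. coprime k M \<and> Q k} =
        (\<Union>x\<in>{x \<in> {..<L}. coprime x L \<and> Q x}. {k \<in> {..<M}. coprime k M \<and> [k = x] (mod L)})"
      (is "?A = ?B")
    proof (intro equalityI subsetI)
      fix k assume k: "k \<in> ?A"
      then have "coprime k L"
        using assms(1) coprime_divisors[of k k L M] by auto
      then show "k \<in> ?B"
        using k L by (auto simp: Q cong_def intro!: bexI[of _ "k mod L"])
    next
      fix k assume "k \<in> ?B"
      then show "k \<in> ?A"
        by (auto simp: cong_def) (metis Q)
    qed
    have "card {k \<in> {..<M}. coprime k M \<and> Q k} = (\<Sum>x\<in>{x \<in> {..<L}. coprime x L \<and> Q x}.
        card {k \<in> {..<M}. coprime k M \<and> [k = x] (mod L)})"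
      unfolding eq by (rule card_UN_disjoint) (auto simp: cong_def)
    also have "\<dots> = (\<Sum>x\<in>{x \<in> {..<L}. coprime x L \<and> Q x}. c)"
    proof (rule sum.cong[OF refl])
      fix x assume "x \<in> {x \<in> {..<L}. coprime x L \<and> Q x}"
      then have "coprime x L" by simp
      then show "card {k \<in> {..<M}. coprime k M \<and> [k = x] (mod L)} = c"
        unfolding c_def by (rule card_units_in_class[OF assms(1,2)])
    qed
    finally show ?thesis by simp
  qed
  \<comment> \<open>The condition that always holds determines the fibre size: \<open>c\<close> is
    the quotient of the totients.\<close>
  have "totient M = totient L * c"
    using count[of "\<lambda>_. True"] card_coprime_lessThan[OF assms(2)] card_coprime_lessThan[OF L] by simp
  with count[of P] per show ?thesis
    by simp
qed

section \<open>Counting units that satisfy the polynomial congruences\<close>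

text \<open>The lcm is a multiple of each \<open>d i\<close> and divides their product. This merges
  the separate coprimality conditions in \<open>eta\<close> into one.\<close>

lemma coprime_LCM_iff:
  fixes x :: nat and d :: "'a \<Rightarrow> nat"
  assumes "finite A"
  shows "coprime x (LCM i\<in>A. d i) \<longleftrightarrow> (\<forall>i\<in>A. coprime x (d i))"
proof
  assume "coprime x (LCM i\<in>A. d i)"
  then show "\<forall>i\<in>A. coprime x (d i)"
    by (metis coprime_divisors dvd_Lcm dvd_refl imageI)
next
  assume "\<forall>i\<in>A. coprime x (d i)"
  then have "coprime x (\<Prod>i\<in>A. d i)"
    by (auto intro: prod_coprime_right)
  moreover have "(LCM i\<in>A. d i) dvd (\<Prod>i\<in>A. d i)"
    using assms by (auto intro!: Lcm_least)
  ultimately show "coprime x (LCM i\<in>A. d i)"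
    by (auto intro: coprime_divisors[OF dvd_refl])
qed

lemma poly_cong_int:
  fixes p :: "int poly"
  assumes "[a = b] (mod n)"
  shows "[poly p a = poly p b] (mod n)"
  by (induction p) (use assms in \<open>auto intro!: cong_add cong_mult\<close>)

text \<open>Brings \<open>eta\<close> into the shape of the right-hand count in
  \<open>card_units_periodic\<close>, with natural residues and a single coprimality
  condition.\<close>

lemma eta_eq_card_nat:
  "eta r G d = card {x \<in> {..<(LCM i\<in>{1..r}. d i)}. coprime x (LCM i\<in>{1..r}. d i) \<and>
     (\<forall>i\<in>{1..r}. int (d i) dvd poly (G i) (int x))}"
  (is "_ = card ?B")
proof -
  have "{x \<in> {0..<int (LCM i\<in>{1..r}. d i)}.
     \<forall>i\<in>{1..r}. [poly (G i) x = 0] (mod int (d i)) \<and> gcd x (int (d i)) = 1} = int ` ?B"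
    (is "?A = _")
  proof (intro equalityI subsetI)
    fix x assume x: "x \<in> ?A"
    then obtain n where "x = int n"
      by (auto elim: nonneg_int_cases)
    with x show "x \<in> int ` ?B"
      by (auto simp: coprime_LCM_iff cong_0_iff simp flip: coprime_iff_gcd_eq_1)
  next
    fix x assume "x \<in> int ` ?B"
    then show "x \<in> ?A"
      by (auto simp: coprime_LCM_iff cong_0_iff simp flip: coprime_iff_gcd_eq_1)
  qed
  then show ?thesis
    unfolding eta_def by (simp add: card_image)
qed

text \<open>Each \<open>d i\<close> divides the lcm, so the divisibility of the polynomial values
  depends only on \<open>k\<close> modulo the lcm, and \<open>card_units_periodic\<close>
  applies.\<close>

lemma card_units_dvd_poly:
  fixes M :: nat and d :: "nat \<Rightarrow> nat"
  assumes "M > 0" "(LCM i\<in>{1..r}. d i) dvd M"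
  shows "totient (LCM i\<in>{1..r}. d i) *
           card {k \<in> {..<M}. coprime k M \<and> (\<forall>i\<in>{1..r}. int (d i) dvd poly (G i) (int k))} =
         totient M * eta r G d"
  unfolding eta_eq_card_nat
proof (rule card_units_periodic[OF assms(2,1)])
  fix k :: nat
  let ?L = "LCM i\<in>{1..r}. d i"
  have "int (d i) dvd poly (G i) (int (k mod ?L)) \<longleftrightarrow> int (d i) dvd poly (G i) (int k)"
    if "i \<in> {1..r}" for i
  proof -
    have "[k mod ?L = k] (mod ?L)"
      by (simp add: cong_def)
    moreover have "d i dvd ?L"
      using that by (intro dvd_Lcm imageI)
    ultimately have "[int (k mod ?L) = int k] (mod int (d i))"
      unfolding cong_int_iff by (rule cong_dvd_modulus_nat)
    then show ?thesis
      by (intro cong_dvd_iff poly_cong_int)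
  qed
  then show "(\<forall>i\<in>{1..r}. int (d i) dvd poly (G i) (int (k mod ?L))) =
      (\<forall>i\<in>{1..r}. int (d i) dvd poly (G i) (int k))"
    by blast
qed

section \<open>Expansion of the product over divisor tuples\<close>

text \<open>Moebius inversion at the gcd, which is positive even for \<open>a = 0\<close>. The
  dependence on \<open>a\<close> moves into the summand, so the index set is the same for all
  \<open>k\<close> and the sums can later be exchanged.\<close>

lemma gcd_eq_sum_dirichlet_conv:
  fixes a :: int and n :: nat
  assumes "n > 0"
  shows "f (nat (gcd a (int n))) =
    (\<Sum>e | e dvd n. if int e dvd a then dirichlet_conv moebius_mu f e else 0)"
proof -
  have "nat (gcd a (int n)) > 0"
    using assms by simp
  then have "f (nat (gcd a (int n))) =
      (\<Sum>e | e dvd nat (gcd a (int n)). dirichlet_conv moebius_mu f e)"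
    by (simp add: moebius_inversion)
  also have "{e. e dvd nat (gcd a (int n))} = {e \<in> {e. e dvd n}. int e dvd a}"
    by (auto simp flip: int_dvd_int_iff)
  also have "(\<Sum>e\<in>\<dots>. dirichlet_conv moebius_mu f e) =
      (\<Sum>e | e dvd n. if int e dvd a then dirichlet_conv moebius_mu f e else 0)"
    using assms by (intro sum.inter_filter) simp
  finally show ?thesis .
qed

lemma prod_gcd_eq_sum_PiE:
  fixes m :: "'i \<Rightarrow> nat" and a :: "'i \<Rightarrow> int"
  assumes "finite I" "\<And>i. i \<in> I \<Longrightarrow> m i > 0"
  shows "(\<Prod>i\<in>I. f i (nat (gcd (a i) (int (m i))))) =
    (\<Sum>d \<in> PiE I (\<lambda>i. {e. e dvd m i}).
       if \<forall>i\<in>I. int (d i) dvd a i then \<Prod>i\<in>I. dirichlet_conv moebius_mu (f i) (d i) else 0)"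
proof -
  have "(\<Prod>i\<in>I. f i (nat (gcd (a i) (int (m i))))) =
      (\<Prod>i\<in>I. \<Sum>e | e dvd m i. if int e dvd a i then dirichlet_conv moebius_mu (f i) e else 0)"
    using assms(2) by (intro prod.cong gcd_eq_sum_dirichlet_conv) auto
  also have "\<dots> = (\<Sum>d \<in> PiE I (\<lambda>i. {e. e dvd m i}).
      \<Prod>i\<in>I. if int (d i) dvd a i then dirichlet_conv moebius_mu (f i) (d i) else 0)"
    using assms by (intro prod_sum_PiE) auto
  \<comment> \<open>A single failing divisibility makes its factor, hence the whole product,
    zero.\<close>
  also have "\<dots> = (\<Sum>d \<in> PiE I (\<lambda>i. {e. e dvd m i}).
       if \<forall>i\<in>I. int (d i) dvd a i then \<Prod>i\<in>I. dirichlet_conv moebius_mu (f i) (d i) else 0)"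
    using assms(1) by (intro sum.cong) (auto intro!: prod_zero)
  finally show ?thesis .
qed

lemma card_totatives_dvd_poly:
  fixes M :: nat and d :: "nat \<Rightarrow> nat"
  assumes "M > 0" "(LCM i\<in>{1..r}. d i) dvd M"
  shows "totient (LCM i\<in>{1..r}. d i) *
           card {k \<in> totatives M. \<forall>i\<in>{1..r}. int (d i) dvd poly (G i) (int k)} =
         totient M * eta r G d"
proof (cases "M = 1")
  case False
  then show ?thesis
    using card_units_dvd_poly[OF assms, of G] assms(1) by (simp add: totatives_eq_lessThan)
next
  case True
  then have one: "(LCM i\<in>{1..r}. d i) = 1"
    using assms(2) by simp
  \<comment> \<open>For \<open>M = 1\<close> all divisibility conditions are trivial, and the sets
    \<open>{1}\<close> and \<open>{0}\<close> both have one element.\<close>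
  then have "d i = 1" if "i \<in> {1..r}" for i
    using that by (metis dvd_Lcm imageI nat_dvd_1_iff_1)
  then show ?thesis
    unfolding eta_eq_card_nat one using True by (simp add: Collect_conv_if)
qed

section \<open>The averaged formula and its independence of \<open>M\<close>\<close>

lemma average_gcd_poly_units:
  fixes r M :: nat and m :: "nat \<Rightarrow> nat"
    and f :: "nat \<Rightarrow> nat \<Rightarrow> complex" and G :: "nat \<Rightarrow> int poly"
  assumes m: "\<And>i. i \<in> {1..r} \<Longrightarrow> m i > 0"
    and M: "M > 0" "(LCM i\<in>{1..r}. m i) dvd M"
  shows "1 / of_nat (totient M) *
           (\<Sum>k\<in>totatives M. \<Prod>i\<in>{1..r}. f i (nat (gcd (poly (G i) (int k)) (int (m i))))) =
         (\<Sum>d \<in> PiE {1..r} (\<lambda>i. {e. e dvd m i}).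
            (\<Prod>i\<in>{1..r}. dirichlet_conv moebius_mu (f i) (d i)) /
              of_nat (totient (LCM i\<in>{1..r}. d i)) * of_nat (eta r G d))"
proof -
  let ?D = "PiE {1..r} (\<lambda>i. {e. e dvd m i})"
  let ?c = "\<lambda>d. \<Prod>i\<in>{1..r}. dirichlet_conv moebius_mu (f i) (d i)"
  let ?N = "\<lambda>d. {k \<in> totatives M. \<forall>i\<in>{1..r}. int (d i) dvd poly (G i) (int k)}"
  have "(\<Sum>k\<in>totatives M. \<Prod>i\<in>{1..r}. f i (nat (gcd (poly (G i) (int k)) (int (m i))))) =
      (\<Sum>k\<in>totatives M. \<Sum>d\<in>?D. if \<forall>i\<in>{1..r}. int (d i) dvd poly (G i) (int k) then ?c d else 0)"
    using m by (intro sum.cong prod_gcd_eq_sum_PiE) auto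
  also have "\<dots> = (\<Sum>d\<in>?D. \<Sum>k\<in>totatives M.
      if \<forall>i\<in>{1..r}. int (d i) dvd poly (G i) (int k) then ?c d else 0)"
    by (rule sum.swap)
  also have "\<dots> = (\<Sum>d\<in>?D. of_nat (card (?N d)) * ?c d)"
    by (intro sum.cong refl) (simp add: sum.inter_filter[symmetric])
  finally have "1 / of_nat (totient M) *
      (\<Sum>k\<in>totatives M. \<Prod>i\<in>{1..r}. f i (nat (gcd (poly (G i) (int k)) (int (m i))))) =
      (\<Sum>d\<in>?D. of_nat (card (?N d)) / of_nat (totient M) * ?c d)"
    by (simp add: sum_divide_distrib)
  also have "\<dots> = (\<Sum>d\<in>?D. ?c d / of_nat (totient (LCM i\<in>{1..r}. d i)) * of_nat (eta r G d))"
  proof (intro sum.cong refl)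
    fix d assume d: "d \<in> ?D"
    let ?L = "LCM i\<in>{1..r}. d i"
    \<comment> \<open>Each \<open>d i\<close> divides \<open>m i\<close>, so \<open>?L\<close>
      divides the lcm of the \<open>m i\<close> and hence \<open>M\<close>, as the unit count
      requires.\<close>
    have "?L dvd (LCM i\<in>{1..r}. m i)"
      by (rule Lcm_least) (use d in \<open>auto simp: PiE_iff intro: dvd_trans[OF _ dvd_Lcm]\<close>)
    with M have L: "?L dvd M"
      using dvd_trans by blast
    then have "?L > 0"
      using M(1) dvd_pos_nat by blast
    then have pos: "totient M \<noteq> 0" "totient ?L \<noteq> 0"
      using M(1) by auto
    have "of_nat (totient ?L) * of_nat (card (?N d)) =
        (of_nat (totient M) * of_nat (eta r G d) :: complex)"
      unfolding of_nat_mult[symmetric] card_totatives_dvd_poly[OF M(1) L, of G] ..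
    then have "of_nat (card (?N d)) / of_nat (totient M) =
        (of_nat (eta r G d) / of_nat (totient ?L) :: complex)"
      using pos by (simp add: frac_eq_eq mult.commute del: totient_0_iff)
    then show "of_nat (card (?N d)) / of_nat (totient M) * ?c d =
        ?c d / of_nat (totient ?L) * of_nat (eta r G d)"
      by simp
  qed
  finally show ?thesis .
qed

theorem theorem2:
  fixes r M :: nat and m :: "nat \<Rightarrow> nat"
    and f :: "nat \<Rightarrow> nat \<Rightarrow> complex" and G :: "nat \<Rightarrow> int poly"
  assumes "r \<ge> 1"
    and "\<And>i. i \<in> {1..r} \<Longrightarrow> m i \<ge> 1"
    and "M \<ge> 1"
    and "(LCM i\<in>{1..r}. m i) dvd M"
  shows "(1 / of_nat (totient M) *
           (\<Sum>k | k \<in> {1..M} \<and> gcd k M = 1.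
              \<Prod>i\<in>{1..r}. f i (nat (gcd (poly (G i) (int k)) (int (m i))))) =
         (\<Sum>d \<in> PiE {1..r} (\<lambda>i. {e. e dvd m i}).
            (\<Prod>i\<in>{1..r}. dirichlet_conv moebius_mu (f i) (d i)) /
              of_nat (totient (LCM i\<in>{1..r}. d i)) * of_nat (eta r G d))) \<and>
         (\<forall>M'\<ge>1. (LCM i\<in>{1..r}. m i) dvd M' \<longrightarrow>
         1 / of_nat (totient M) *
           (\<Sum>k | k \<in> {1..M} \<and> gcd k M = 1.
              \<Prod>i\<in>{1..r}. f i (nat (gcd (poly (G i) (int k)) (int (m i))))) =
         1 / of_nat (totient M') *
           (\<Sum>k | k \<in> {1..M'} \<and> gcd k M' = 1.
              \<Prod>i\<in>{1..r}. f i (nat (gcd (poly (G i) (int k)) (int (m i))))))"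
proof -
  have totatives: "{k. k \<in> {1..n} \<and> gcd k n = 1} = totatives n" for n :: nat
    unfolding totatives_def coprime_iff_gcd_eq_1 by auto
  have m: "m i > 0" if "i \<in> {1..r}" for i
    using assms(2)[OF that] by simp
  have avg: "1 / of_nat (totient n) *
      (\<Sum>k\<in>totatives n. \<Prod>i\<in>{1..r}. f i (nat (gcd (poly (G i) (int k)) (int (m i))))) =
      (\<Sum>d \<in> PiE {1..r} (\<lambda>i. {e. e dvd m i}).
         (\<Prod>i\<in>{1..r}. dirichlet_conv moebius_mu (f i) (d i)) /
           of_nat (totient (LCM i\<in>{1..r}. d i)) * of_nat (eta r G d))"
    if "n \<ge> 1" "(LCM i\<in>{1..r}. m i) dvd n" for n
    using that by (intro average_gcd_poly_units m) simp_all
  show ?thesis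
    unfolding totatives
    \<comment> \<open>The sum over divisor tuples does not involve the modulus, so the averages for
      \<open>M\<close> and \<open>M'\<close> both equal it.\<close>
    by (intro conjI allI impI avg[OF assms(3,4)] trans[OF avg[OF assms(3,4)] avg[symmetric]])
qed

end
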